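(* Let $\mathcal{M}=(\mathcal{T},\mathcal{V},\mu)$ be a causally expressive model. Then for every non-deterministic functional network $\{(S_j,P_j)\}_{j\in J}$ in $\mathcal{M}$, where $(S_j,P_j)$ computes $F_j$ and $(S,P)$ is the network composition, \[ \{\mathrm{lfp}(G_f)\mid f\in\textstyle\prod_{j\in J}F_j\}\subseteq\mu_S(P). \]
   Context: A cpo is a directed-complete poset with least element $\bot$; $\mathbf{Cpo}^s$ is the category of cpos and strict Scott-continuous maps. $K(D)$ denotes compact elements, $K(d)=\{b\in K(D)\mid b\sqsubseteq d\}$; $[D\to E]$ continuous maps. Covering: $x\prec y$ iff $x\sqsubseteq y$, $x\ne y$, nothing strictly between. Relative cover: $b\prec c$ relative to $d$ means $b,c\in K(d)$ and $b\prec c$. A covering sequence in an algebraic cpo is a nonempty finite or infinite sequence $(b_n)$ of compact elements with $b_0=\bot$ and $b_n\prec b_{n+1}$; it is a covering sequence for $d$ if $\bigsqcup b_n=d$. Fix a class of channel names; a sort is a set of channels. A model $\mathcal{M}=(\mathcal{T},\mathcal{V},\mu)$: cpos $\mathcal{T}_S$ with strict continuous restriction maps $\rho^S_T:\mathcal{T}_S\to\mathcal{T}_T$ ($S\supseteq T$) satisfying $\rho^T_U\circ\rho^S_T=\rho^S_U$, $\rho^S_S=\mathrm{id}$; $\mathcal{V}_S=\prod_{\alpha\in S}\mathcal{V}_{\{\alpha\}}$ with projections $\pi^S_T$; strict continuous $\mu_S:\mathcal{T}_S\to\mathcal{V}_S$ with $\mu_T\circ\rho^S_T=\pi^S_T\circ\mu_S$.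 Write $\hat\rho^S_T=\mu_T\circ\rho^S_T$. Incremental: an $\omega$-algebraic cpo $D$ is incremental if for $b\sqsubseteq c$ in $K(D)$ there is a finite chain $b=b_0\prec\cdots\prec b_n=c$; a strict continuous $f:D\to E$ of incremental domains is an incremental morphism if (i) $b\prec c$ relative to $d$ implies $f(b)\prec f(c)$ relative to $f(d)$ or $f(b)=f(c)\in K(f(d))$, and (ii) if $b'\prec c'$ relative to $d'=f(d)$ then there are $b\prec c$ relative to $d$ with $f(b)=b'$, $f(c)=c'$. The model is incremental if each $\mathcal{T}_S$ is incremental and each $\rho^S_T$ is an incremental morphism. Causal expressiveness: for a chain $C=(b_k)$ of compact elements in an algebraic cpo with $\bigsqcup b_k=d$, put $\|b\|_C=\min\{k\mid b\sqsubseteq b_k\}$ for $b\in K(d)$, and $b<_Cc$ iff $\|b\|_C<\|c\|_C$. For $t\in\mathcal{T}_S$ with $\mu_S(t)=d$, define $b<_tc$ (for $b,c\in K(d)$) iff for every covering sequence $(t_k)$ for $t$, $\min\{k\mid b\sqsubseteq\mu_S(t_k)\}<\min\{k\mid c\sqsubseteq\mu_S(t_k)\}$. A model is causally expressive if it is incremental, each $\mathcal{V}_S$ is $\omega$-algebraic, and for every sort $S$, $d\in\mathcal{V}_S$ and chain $C=(b_k)$ of compact elements with $\bigsqcup b_k=d$, there is $t\in\mathcal{T}_S$ with $\mu_S(t)=d$ and $<_t\supseteq<_C$. A process is $(S,P)$ with $P\subseteq\mathcal{T}_S$. Network composition of $\{(S_j,P_j)\}_{j\in J}$: $(S,P)$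 with $S=\bigcup_jS_j$, $P=\{t\in\mathcal{T}_S\mid\forall j.\ \rho^S_{S_j}(t)\in P_j\}$. $(S,P)$ with $S=I\cup O$ computes $F\subseteq[\mathcal{V}_I\to\mathcal{V}_O]$ if for all $t\in\mathcal{T}_S$: $t\in P$ iff there is $f\in F$ with (1) $\hat\rho^S_O(t)=f(\hat\rho^S_I(t))$ and (2) for all $u\prec v$ relative to $t$, $\hat\rho^S_O(v)\sqsubseteq f(\hat\rho^S_I(u))$. A non-deterministic functional network is a family with each $S_j=I_j\cup O_j$, $(S_j,P_j)$ computing $F_j\subseteq[\mathcal{V}_{I_j}\to\mathcal{V}_{O_j}]$, and each $\alpha\in\bigcup_jS_j$ in exactly one $O_j$. For $f=(f_j)\in\prod_jF_j$, $G_f:\mathcal{V}_S\to\mathcal{V}_S$ has $\alpha$-component $\pi^{O_j}_{\{\alpha\}}\circ f_j\circ\pi^S_{I_j}$ for the unique $j$ with $\alpha\in O_j$; $\mathrm{lfp}(G_f)=\bigsqcup_kG_f^k(\bot)$. *)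

theory Defs
  imports "HOL-Algebra.Lattice" "HOL-Library.Extended_Nat" "HOL-Library.Countable_Set"
begin

section \<open>Domains\<close>

definition directed :: "('a, 'm) gorder_scheme \<Rightarrow> 'a set \<Rightarrow> bool" where
  "directed D A \<longleftrightarrow> A \<subseteq> carrier D \<and> A \<noteq> {} \<and>
     (\<forall>x\<in>A. \<forall>y\<in>A. \<exists>z\<in>A. x \<sqsubseteq>\<^bsub>D\<^esub> z \<and> y \<sqsubseteq>\<^bsub>D\<^esub> z)"

locale cpo = partial_order D + weak_partial_order_bottom D for D (structure) +
  assumes directed_complete: "directed D A \<Longrightarrow> \<exists>s. is_lub D s A"

definition scott_continuous ::
  "('a, 'm) gorder_scheme \<Rightarrow> ('b, 'n) gorder_scheme \<Rightarrow> ('a \<Rightarrow> 'b) \<Rightarrow> bool" where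
  "scott_continuous D E f \<longleftrightarrow>
     f \<in> carrier D \<rightarrow> carrier E \<and> isotone D E f \<and>
     (\<forall>A s. directed D A \<and> is_lub D s A \<longrightarrow> is_lub E (f s) (f ` A))"

definition strict_continuous ::
  "('a, 'm) gorder_scheme \<Rightarrow> ('b, 'n) gorder_scheme \<Rightarrow> ('a \<Rightarrow> 'b) \<Rightarrow> bool" where
  "strict_continuous D E f \<longleftrightarrow> scott_continuous D E f \<and> f \<bottom>\<^bsub>D\<^esub> = \<bottom>\<^bsub>E\<^esub>"

text \<open>The set \<open>[D \<rightarrow> E]\<close>.  Maps are extensional, so that distinct members differ on \<open>D\<close>.\<close>

definition continuous_maps ::
  "('a, 'm) gorder_scheme \<Rightarrow> ('b, 'n) gorder_scheme \<Rightarrow> ('a \<Rightarrow> 'b) set" where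
  "continuous_maps D E = {f \<in> carrier D \<rightarrow>\<^sub>E carrier E. scott_continuous D E f}"

definition compacts :: "('a, 'm) gorder_scheme \<Rightarrow> 'a set" where
  "compacts D = {b \<in> carrier D.
     \<forall>A s. directed D A \<and> is_lub D s A \<and> b \<sqsubseteq>\<^bsub>D\<^esub> s \<longrightarrow> (\<exists>a\<in>A. b \<sqsubseteq>\<^bsub>D\<^esub> a)}"

definition compacts_below :: "('a, 'm) gorder_scheme \<Rightarrow> 'a \<Rightarrow> 'a set" where
  "compacts_below D d = {b \<in> compacts D. b \<sqsubseteq>\<^bsub>D\<^esub> d}"

definition algebraic :: "('a, 'm) gorder_scheme \<Rightarrow> bool" where
  "algebraic D \<longleftrightarrow> cpo D \<and>
     (\<forall>d\<in>carrier D. directed D (compacts_below D d) \<and> is_lub D d (compacts_below D d))"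

definition omega_algebraic :: "('a, 'm) gorder_scheme \<Rightarrow> bool" where
  "omega_algebraic D \<longleftrightarrow> algebraic D \<and> countable (compacts D)"

definition covers :: "('a, 'm) gorder_scheme \<Rightarrow> 'a \<Rightarrow> 'a \<Rightarrow> bool" where
  "covers D x y \<longleftrightarrow> x \<in> carrier D \<and> y \<in> carrier D \<and> x \<sqsubseteq>\<^bsub>D\<^esub> y \<and> x \<noteq> y \<and>
     \<not> (\<exists>z\<in>carrier D. x \<sqsubseteq>\<^bsub>D\<^esub> z \<and> x \<noteq> z \<and> z \<sqsubseteq>\<^bsub>D\<^esub> y \<and> z \<noteq> y)"

definition covers_relative :: "('a, 'm) gorder_scheme \<Rightarrow> 'a \<Rightarrow> 'a \<Rightarrow> 'a \<Rightarrow> bool" where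
  "covers_relative D d b c \<longleftrightarrow>
     b \<in> compacts_below D d \<and> c \<in> compacts_below D d \<and> covers D b c"

text \<open>
  A nonempty finite or infinite sequence is a pair of a length \<open>N \<noteq> 0\<close> (possibly \<open>\<infinity>\<close>)
  and a function on \<open>nat\<close>, whose values at indices \<open>k \<ge> N\<close> are irrelevant.
\<close>

definition covering_sequence :: "('a, 'm) gorder_scheme \<Rightarrow> enat \<Rightarrow> (nat \<Rightarrow> 'a) \<Rightarrow> bool" where
  "covering_sequence D N b \<longleftrightarrow> N \<noteq> 0 \<and>
     (\<forall>k. enat k < N \<longrightarrow> b k \<in> compacts D) \<and> b 0 = \<bottom>\<^bsub>D\<^esub> \<and>
     (\<forall>k. enat (Suc k) < N \<longrightarrow> covers D (b k) (b (Suc k)))"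

definition covering_sequence_for ::
  "('a, 'm) gorder_scheme \<Rightarrow> 'a \<Rightarrow> enat \<Rightarrow> (nat \<Rightarrow> 'a) \<Rightarrow> bool" where
  "covering_sequence_for D d N b \<longleftrightarrow>
     covering_sequence D N b \<and> is_lub D d {b k |k. enat k < N}"

definition incremental_domain :: "('a, 'm) gorder_scheme \<Rightarrow> bool" where
  "incremental_domain D \<longleftrightarrow> omega_algebraic D \<and>
     (\<forall>b\<in>compacts D. \<forall>c\<in>compacts D. b \<sqsubseteq>\<^bsub>D\<^esub> c \<longrightarrow> (covers D)\<^sup>*\<^sup>* b c)"

definition incremental_morphism ::
  "('a, 'm) gorder_scheme \<Rightarrow> ('b, 'n) gorder_scheme \<Rightarrow> ('a \<Rightarrow> 'b) \<Rightarrow> bool" where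
  "incremental_morphism D E f \<longleftrightarrow>
     incremental_domain D \<and> incremental_domain E \<and> strict_continuous D E f \<and>
     (\<forall>d\<in>carrier D. \<forall>b c. covers_relative D d b c \<longrightarrow>
        covers_relative E (f d) (f b) (f c) \<or>
        f b = f c \<and> f c \<in> compacts_below E (f d)) \<and>
     (\<forall>d\<in>carrier D. \<forall>b' c'. covers_relative E (f d) b' c' \<longrightarrow>
        (\<exists>b c. covers_relative D d b c \<and> f b = b' \<and> f c = c'))"

text \<open>The least fixed point as the supremum of the Kleene iterates.\<close>

definition kleene_lfp :: "('a, 'm) gorder_scheme \<Rightarrow> ('a \<Rightarrow> 'a) \<Rightarrow> 'a" where
  "kleene_lfp D g = \<Squnion>\<^bsub>D\<^esub> (range (\<lambda>k. (g ^^ k) \<bottom>\<^bsub>D\<^esub>))"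

section \<open>Models\<close>

text \<open>
  Channels are the elements of \<open>'c\<close> and sorts are the sets of channels.  The field \<open>trc\<close> gives
  the domains \<open>\<T>\<^sub>S\<close>, \<open>res M S U\<close> is the restriction \<open>\<rho>\<close> from \<open>\<T>\<^sub>S\<close> to \<open>\<T>\<^sub>U\<close>, and \<open>obs\<close> is \<open>\<mu>\<close>.
  The field \<open>val\<close> gives the domain of values of a single channel, which stands for \<open>\<V>\<close> at the
  corresponding singleton sort.  The domain \<open>\<V>\<^sub>S\<close> is then the product \<open>vals M S\<close>, consisting
  of functions that are \<^const>\<open>undefined\<close> outside \<open>S\<close>, and the projection to \<open>\<V>\<^sub>U\<close>
  maps \<open>x\<close> to \<open>restrict x U\<close>.
\<close>

record ('c, 't, 'v) model_data =
  trc :: "'c set \<Rightarrow> 't gorder"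
  res :: "'c set \<Rightarrow> 'c set \<Rightarrow> 't \<Rightarrow> 't"
  val :: "'c \<Rightarrow> 'v gorder"
  obs :: "'c set \<Rightarrow> 't \<Rightarrow> 'c \<Rightarrow> 'v"

definition vals :: "('c, 't, 'v) model_data \<Rightarrow> 'c set \<Rightarrow> ('c \<Rightarrow> 'v) gorder" where
  "vals M S =
     \<lparr>carrier = (\<Pi>\<^sub>E \<alpha>\<in>S. carrier (val M \<alpha>)), eq = (=),
      le = (\<lambda>x y. \<forall>\<alpha>\<in>S. x \<alpha> \<sqsubseteq>\<^bsub>val M \<alpha>\<^esub> y \<alpha>)\<rparr>"

locale model =
  fixes M :: "('c, 't, 'v) model_data"
  assumes trc_cpo: "cpo (trc M S)"
    and val_cpo: "cpo (val M \<alpha>)"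
    and res_strict_continuous:
      "U \<subseteq> S \<Longrightarrow> strict_continuous (trc M S) (trc M U) (res M S U)"
    and res_id: "t \<in> carrier (trc M S) \<Longrightarrow> res M S S t = t"
    and res_comp: "\<lbrakk>W \<subseteq> U; U \<subseteq> S; t \<in> carrier (trc M S)\<rbrakk>
      \<Longrightarrow> res M U W (res M S U t) = res M S W t"
    and obs_strict_continuous: "strict_continuous (trc M S) (vals M S) (obs M S)"
    and obs_natural: "\<lbrakk>U \<subseteq> S; t \<in> carrier (trc M S)\<rbrakk>
      \<Longrightarrow> obs M U (res M S U t) = restrict (obs M S t) U"

text \<open>The map \<open>\<rho>\<close> with a hat, that is, \<open>\<mu>\<^sub>U \<circ> \<rho>\<close>.\<close>

definition obs_res :: "('c, 't, 'v) model_data \<Rightarrow> 'c set \<Rightarrow> 'c set \<Rightarrow> 't \<Rightarrow> 'c \<Rightarrow> 'v" where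
  "obs_res M S U t = obs M U (res M S U t)"

definition incremental_model :: "('c, 't, 'v) model_data \<Rightarrow> bool" where
  "incremental_model M \<longleftrightarrow> model M \<and>
     (\<forall>S. incremental_domain (trc M S)) \<and>
     (\<forall>S U. U \<subseteq> S \<longrightarrow> incremental_morphism (trc M S) (trc M U) (res M S U))"

definition chain_norm :: "('a, 'm) gorder_scheme \<Rightarrow> (nat \<Rightarrow> 'a) \<Rightarrow> 'a \<Rightarrow> nat" where
  "chain_norm D C b = (LEAST k. b \<sqsubseteq>\<^bsub>D\<^esub> C k)"

definition chain_less :: "('a, 'm) gorder_scheme \<Rightarrow> (nat \<Rightarrow> 'a) \<Rightarrow> 'a \<Rightarrow> 'a \<Rightarrow> bool" where
  "chain_less D C b c \<longleftrightarrow> chain_norm D C b < chain_norm D C c"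

definition trace_less ::
  "('c, 't, 'v) model_data \<Rightarrow> 'c set \<Rightarrow> 't \<Rightarrow> ('c \<Rightarrow> 'v) \<Rightarrow> ('c \<Rightarrow> 'v) \<Rightarrow> bool" where
  "trace_less M S t b c \<longleftrightarrow>
     (\<forall>N x. covering_sequence_for (trc M S) t N x \<longrightarrow>
        (LEAST k. enat k < N \<and> b \<sqsubseteq>\<^bsub>vals M S\<^esub> obs M S (x k))
        < (LEAST k. enat k < N \<and> c \<sqsubseteq>\<^bsub>vals M S\<^esub> obs M S (x k)))"

definition causally_expressive :: "('c, 't, 'v) model_data \<Rightarrow> bool" where
  "causally_expressive M \<longleftrightarrow>
     incremental_model M \<and> (\<forall>S. omega_algebraic (vals M S)) \<and>
     (\<forall>S. \<forall>d\<in>carrier (vals M S). \<forall>C.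
        (\<forall>k. C k \<in> compacts (vals M S) \<and> C k \<sqsubseteq>\<^bsub>vals M S\<^esub> C (Suc k)) \<and>
        is_lub (vals M S) d (range C) \<longrightarrow>
        (\<exists>t\<in>carrier (trc M S). obs M S t = d \<and>
           (\<forall>b\<in>compacts_below (vals M S) d. \<forall>c\<in>compacts_below (vals M S) d.
              chain_less (vals M S) C b c \<longrightarrow> trace_less M S t b c)))"

section \<open>Processes and networks\<close>

type_synonym ('c, 't) process = "'c set \<times> 't set"

definition is_process :: "('c, 't, 'v) model_data \<Rightarrow> ('c, 't) process \<Rightarrow> bool" where
  "is_process M Q \<longleftrightarrow> snd Q \<subseteq> carrier (trc M (fst Q))"

definition network_composition ::
  "('c, 't, 'v) model_data \<Rightarrow> 'j set \<Rightarrow> ('j \<Rightarrow> ('c, 't) process) \<Rightarrow> ('c, 't) process" where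
  "network_composition M J Q =
     (let S = (\<Union>j\<in>J. fst (Q j))
      in (S, {t \<in> carrier (trc M S). \<forall>j\<in>J. res M S (fst (Q j)) t \<in> snd (Q j)}))"

definition computes ::
  "('c, 't, 'v) model_data \<Rightarrow> ('c, 't) process \<Rightarrow> 'c set \<Rightarrow> 'c set
    \<Rightarrow> (('c \<Rightarrow> 'v) \<Rightarrow> ('c \<Rightarrow> 'v)) set \<Rightarrow> bool" where
  "computes M Q I Out F \<longleftrightarrow>
     (let S = fst Q; P = snd Q in
        is_process M Q \<and> S = I \<union> Out \<and>
        F \<subseteq> continuous_maps (vals M I) (vals M Out) \<and>
        (\<forall>t\<in>carrier (trc M S). t \<in> P \<longleftrightarrow>
           (\<exists>f\<in>F. obs_res M S Out t = f (obs_res M S I t) \<and>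
              (\<forall>u v. covers_relative (trc M S) t u v \<longrightarrow>
                 obs_res M S Out v \<sqsubseteq>\<^bsub>vals M Out\<^esub> f (obs_res M S I u)))))"

definition functional_network ::
  "('c, 't, 'v) model_data \<Rightarrow> 'j set \<Rightarrow> ('j \<Rightarrow> ('c, 't) process) \<Rightarrow> ('j \<Rightarrow> 'c set) \<Rightarrow> ('j \<Rightarrow> 'c set)
    \<Rightarrow> ('j \<Rightarrow> (('c \<Rightarrow> 'v) \<Rightarrow> ('c \<Rightarrow> 'v)) set) \<Rightarrow> bool" where
  "functional_network M J Q I Out F \<longleftrightarrow>
     (\<forall>j\<in>J. computes M (Q j) (I j) (Out j) (F j)) \<and>
     (\<forall>\<alpha>\<in>(\<Union>j\<in>J. fst (Q j)). \<exists>!j. j \<in> J \<and> \<alpha> \<in> Out j)"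

definition network_map ::
  "'j set \<Rightarrow> 'c set \<Rightarrow> ('j \<Rightarrow> 'c set) \<Rightarrow> ('j \<Rightarrow> 'c set) \<Rightarrow> ('j \<Rightarrow> ('c \<Rightarrow> 'v) \<Rightarrow> ('c \<Rightarrow> 'v))
    \<Rightarrow> ('c \<Rightarrow> 'v) \<Rightarrow> ('c \<Rightarrow> 'v)" where
  "network_map J S I Out f x =
     (\<lambda>\<alpha>\<in>S. let j = (THE j. j \<in> J \<and> \<alpha> \<in> Out j) in f j (restrict x (I j)) \<alpha>)"

end

theory Submission
  imports Defs
begin

text \<open>
  Since \<open>\<V>\<^sub>S\<close> is \<open>\<omega>\<close>-algebraic, there is a chain \<open>C\<close> of compact elements with supremum
  \<open>lfp G\<close> such that \<open>C\<^sub>0 = \<bottom>\<close> and \<open>C\<^sub>k\<^sub>+\<^sub>1 \<sqsubseteq> G C\<^sub>k\<close>; causal expressiveness gives a trace \<open>t\<close>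
  that observes \<open>lfp G\<close> and respects the order of \<open>C\<close>.  Let \<open>u \<prec> v\<close> relative to \<open>t\<close>, and choose
  a covering sequence for \<open>t\<close> through \<open>u\<close> and \<open>v\<close>.  If \<open>e \<sqsubseteq> \<mu> v\<close> is compact and \<open>k > 0\<close> is least with
  \<open>e \<sqsubseteq> C\<^sub>k\<close>, then \<open>C\<^sub>k\<^sub>-\<^sub>1\<close> must be observed strictly earlier than \<open>e\<close>, so that \<open>C\<^sub>k\<^sub>-\<^sub>1 \<sqsubseteq> \<mu> u\<close> and
  \<open>e \<sqsubseteq> C\<^sub>k \<sqsubseteq> G (\<mu> u)\<close>.  Hence \<open>\<mu> v \<sqsubseteq> G (\<mu> u)\<close>.  Every cover relative to a restriction of \<open>t\<close>
  lifts to a cover relative to \<open>t\<close>, so each component process accepts its restriction of \<open>t\<close>.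
\<close>

section \<open>Suprema and directed sets\<close>

text \<open>\<open>Upper\<close> tests only those members of \<open>A\<close> that lie in the
  carrier; for \<open>A\<close> inside the carrier the bounds can be quantified over all of
  \<open>A\<close>.\<close>

lemma is_lub_iff:
  assumes "A \<subseteq> carrier D"
  shows "is_lub D s A \<longleftrightarrow> s \<in> carrier D \<and> (\<forall>a\<in>A. a \<sqsubseteq>\<^bsub>D\<^esub> s) \<and>
    (\<forall>y\<in>carrier D. (\<forall>a\<in>A. a \<sqsubseteq>\<^bsub>D\<^esub> y) \<longrightarrow> s \<sqsubseteq>\<^bsub>D\<^esub> y)"
proof -
  have "Upper D A = {u \<in> carrier D. \<forall>a\<in>A. a \<sqsubseteq>\<^bsub>D\<^esub> u}"
    using assms by (auto simp: Upper_def)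
  then show ?thesis
    by (auto simp: least_def)
qed

lemma is_lub_closed: "is_lub D s A \<Longrightarrow> s \<in> carrier D"
  by (auto simp: least_def Upper_def)

lemma compacts_inaccessible:
  "\<lbrakk>b \<in> compacts D; directed D A; is_lub D s A; b \<sqsubseteq>\<^bsub>D\<^esub> s\<rbrakk> \<Longrightarrow> \<exists>a\<in>A. b \<sqsubseteq>\<^bsub>D\<^esub> a"
  by (auto simp: compacts_def)

text \<open>Monotonicity is assumed pointwise and not as \<open>isotone\<close>, which would also
  assert that both orders are weak partial orders. This allows direct use for evaluation at one
  channel of a product.\<close>

lemma directed_image:
  assumes "directed D A" "f \<in> carrier D \<rightarrow> carrier E"
    and "\<And>x y. \<lbrakk>x \<in> carrier D; y \<in> carrier D; x \<sqsubseteq>\<^bsub>D\<^esub> y\<rbrakk> \<Longrightarrow> f x \<sqsubseteq>\<^bsub>E\<^esub> f y"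
  shows "directed E (f ` A)"
  unfolding directed_def
proof (intro conjI ballI)
  show "f ` A \<subseteq> carrier E" "f ` A \<noteq> {}"
    using assms(1,2) by (auto simp: directed_def)
  fix x y assume "x \<in> f ` A" "y \<in> f ` A"
  then obtain a b where ab: "a \<in> A" "b \<in> A" "x = f a" "y = f b"
    by blast
  then obtain c where "c \<in> A" "a \<sqsubseteq>\<^bsub>D\<^esub> c" "b \<sqsubseteq>\<^bsub>D\<^esub> c"
    using assms(1) unfolding directed_def by meson
  moreover have "a \<in> carrier D" "b \<in> carrier D" "c \<in> carrier D"
    using assms(1) ab \<open>c \<in> A\<close> by (auto simp: directed_def)
  ultimately show "\<exists>z\<in>f ` A. x \<sqsubseteq>\<^bsub>E\<^esub> z \<and> y \<sqsubseteq>\<^bsub>E\<^esub> z"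
    using ab assms(3) by (intro bexI[of _ "f c"]) auto
qed

lemma directed_image_scott_continuous:
  assumes "scott_continuous D E f" "directed D A"
  shows "directed E (f ` A)"
  using assms by (intro directed_image[OF assms(2)]) (auto simp: scott_continuous_def isotone_def)

lemma successively_nth:
  assumes "successively R xs" "Suc i < length xs"
  shows "R (xs ! i) (xs ! Suc i)"
  using assms
  by (induction R xs arbitrary: i rule: successively.induct) (auto simp: nth_Cons split: nat.splits)

section \<open>Chains and compact elements in a cpo\<close>

context cpo
begin

lemma directed_bound_finite:
  assumes "directed D A" "finite B" "B \<subseteq> A"
  shows "\<exists>z\<in>A. \<forall>b\<in>B. b \<sqsubseteq> z"
  using assms(2,3)
proof (induction B)
  case empty
  then show ?case
    using assms(1) by (auto simp: directed_def)
next
  case (insert x B)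
  then obtain z where z: "z \<in> A" "\<forall>b\<in>B. b \<sqsubseteq> z"
    by auto
  obtain w where w: "w \<in> A" "x \<sqsubseteq> w" "z \<sqsubseteq> w"
    using assms(1) insert.prems z(1) unfolding directed_def by blast
  have "b \<sqsubseteq> w" if "b \<in> B" for b
    using assms(1) insert.prems z w that
    by (intro le_trans[of b z w]) (auto simp: directed_def subset_iff)
  with w show ?case
    by auto
qed

lemma chain_mono:
  assumes "\<And>k. C k \<in> carrier D" "\<And>k. C k \<sqsubseteq> C (Suc k)" "m \<le> n"
  shows "C m \<sqsubseteq> C n"
  using assms(3)
proof (induction n rule: dec_induct)
  case (step n)
  then show ?case
    using le_trans[of "C m" "C n" "C (Suc n)"] assms(1,2) by blast
qed (use assms(1) in simp)

lemma directed_chain: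
  assumes "\<And>k. C k \<in> carrier D" "\<And>k. C k \<sqsubseteq> C (Suc k)"
  shows "directed D (range C)"
proof -
  have "\<exists>z\<in>range C. C m \<sqsubseteq> z \<and> C n \<sqsubseteq> z" for m n :: nat
    using chain_mono[of C, OF assms, of m "max m n"] chain_mono[of C, OF assms, of n "max m n"] by auto
  then show ?thesis
    using assms(1) unfolding directed_def by auto
qed

lemma bottom_compact: "\<bottom> \<in> compacts D"
  by (auto simp: compacts_def directed_def)

text \<open>In an algebraic domain \<open>x\<close> is the supremum of the compact elements below
  it, and \<open>y\<close> bounds all of these. Inequalities below are reduced in this way to
  compact elements.\<close>

lemma le_if_compacts_below:
  assumes "algebraic D" "x \<in> carrier D" "y \<in> carrier D"
    and "\<And>e. \<lbrakk>e \<in> compacts D; e \<sqsubseteq> x\<rbrakk> \<Longrightarrow> e \<sqsubseteq> y"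
  shows "x \<sqsubseteq> y"
proof -
  have lub: "is_lub D x (compacts_below D x)"
    using assms(1,2) by (simp add: algebraic_def)
  have "compacts_below D x \<subseteq> carrier D"
    by (auto simp: compacts_below_def compacts_def)
  then show ?thesis
    using lub assms(3,4) by (simp add: is_lub_iff compacts_below_def)
qed

section \<open>The least fixed point as the supremum of a compact chain\<close>

text \<open>The supremum operator picks some least upper bound, so uniqueness is what identifies the
  pick with \<open>s\<close>.\<close>

lemma is_lub_kleene_lfp:
  assumes "is_lub D s (range (\<lambda>k. (g ^^ k) \<bottom>))"
  shows "kleene_lfp D g = s"
  unfolding kleene_lfp_def sup_def using assms by (rule some_equality) (rule least_unique[OF _ assms])

text \<open>Kleene iterates need not be compact, so a slower chain is built below them. Each
  \<open>C (Suc k)\<close> is a compact element below \<open>g (C k)\<close> that also collects the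
  enumerated compact elements met so far. Every compact element below some \<open>g (C i)\<close> is
  thus collected eventually, so the supremum \<open>s\<close> bounds all \<open>g (C i)\<close>, and
  continuity yields \<open>g s \<sqsubseteq> s\<close>.\<close>

lemma kleene_compact_chain:
  assumes omega: "omega_algebraic D" and cont: "scott_continuous D D g"
  obtains C where "C 0 = \<bottom>" "\<And>k. C k \<in> compacts D" "\<And>k. C k \<sqsubseteq> C (Suc k)"
    "\<And>k. C (Suc k) \<sqsubseteq> g (C k)" "is_lub D (kleene_lfp D g) (range C)"
    "g (kleene_lfp D g) = kleene_lfp D g"
proof -
  have alg: "algebraic D" and cnt: "countable (compacts D)"
    using omega by (auto simp: omega_algebraic_def)
  have gclosed: "x \<in> carrier D \<Longrightarrow> g x \<in> carrier D" for x
    using cont by (auto simp: scott_continuous_def)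
  have gmono: "\<lbrakk>x \<in> carrier D; y \<in> carrier D; x \<sqsubseteq> y\<rbrakk> \<Longrightarrow> g x \<sqsubseteq> g y" for x y
    using cont by (auto simp: scott_continuous_def isotone_def)
  define e where "e = from_nat_into (compacts D)"
  have e: "e k \<in> compacts D" for k
    unfolding e_def using bottom_compact by (blast intro: from_nat_into)
  have e_surj: "\<exists>n. e n = b" if "b \<in> compacts D" for b
    unfolding e_def using cnt that from_nat_into_surj by metis
  have comp: "b \<in> compacts D \<Longrightarrow> b \<in> carrier D" for b
    by (simp add: compacts_def)
  \<comment> \<open>The relation between \<open>x = C n\<close> and \<open>y = C (Suc n)\<close>.
    Only the indices \<open>i \<le> n\<close> are tested, so that finitely many elements have to be
    bounded by \<open>y\<close>.\<close>
  define R where "R n x y \<longleftrightarrow> x \<sqsubseteq> y \<and> y \<sqsubseteq> g x \<and> (\<forall>i\<le>n. e i \<sqsubseteq> g x \<longrightarrow> e i \<sqsubseteq> y)"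
    for n :: nat and x y
  \<comment> \<open>The invariant \<open>C n \<sqsubseteq> g (C n)\<close> places \<open>C n\<close>
    itself among the compact elements below \<open>g (C n)\<close>; these are directed, so a next
    element above \<open>C n\<close> can be found there.\<close>
  have "\<exists>C. \<forall>n. (C n \<in> compacts D \<and> C n \<sqsubseteq> g (C n) \<and> (n = 0 \<longrightarrow> C n = \<bottom>)) \<and> R n (C n) (C (Suc n))"
  proof (rule dependent_nat_choice)
    show "\<exists>x. x \<in> compacts D \<and> x \<sqsubseteq> g x \<and> ((0::nat) = 0 \<longrightarrow> x = \<bottom>)"
      using bottom_compact gclosed by auto
  next
    fix x and n :: nat
    assume x: "x \<in> compacts D \<and> x \<sqsubseteq> g x \<and> (n = 0 \<longrightarrow> x = \<bottom>)"
    let ?B = "insert x {e i |i. i \<le> n \<and> e i \<sqsubseteq> g x}"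
    have "directed D (compacts_below D (g x))"
      using alg x comp gclosed by (auto simp: algebraic_def)
    moreover have "finite ?B"
      by simp
    moreover have "?B \<subseteq> compacts_below D (g x)"
      using x e by (auto simp: compacts_below_def)
    ultimately obtain y where y: "y \<in> compacts_below D (g x)" "\<forall>b\<in>?B. b \<sqsubseteq> y"
      using directed_bound_finite by meson
    then have "R n x y"
      by (auto simp: R_def compacts_below_def)
    moreover have "y \<sqsubseteq> g y"
    proof (rule le_trans[of y "g x"])
      show "y \<sqsubseteq> g x"
        using y by (simp add: compacts_below_def)
      show "g x \<sqsubseteq> g y"
        using x y comp by (intro gmono) (auto simp: compacts_below_def)
    qed (use x y comp gclosed in \<open>auto simp: compacts_below_def\<close>)
    ultimately show "\<exists>y. (y \<in> compacts D \<and> y \<sqsubseteq> g y \<and> (Suc n = 0 \<longrightarrow> y = \<bottom>)) \<and> R n x y"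
      using y by (auto simp: compacts_below_def)
  qed
  then obtain C where C: "C 0 = \<bottom>" "\<And>k. C k \<in> compacts D" and CR: "\<And>k. R k (C k) (C (Suc k))"
    by metis
  have Cc: "C k \<in> carrier D" for k
    using C comp by blast
  have step: "C k \<sqsubseteq> C (Suc k)" and le_g: "C (Suc k) \<sqsubseteq> g (C k)" for k
    using CR by (auto simp: R_def)
  have dir: "directed D (range C)"
    using directed_chain Cc step by blast
  then obtain s where s: "is_lub D s (range C)"
    using directed_complete by blast
  have sc: "s \<in> carrier D"
    using s by (rule is_lub_closed)
  have Cs: "C k \<sqsubseteq> s" for k
    using s Cc by (subst (asm) is_lub_iff) auto
  have s_least: "s \<sqsubseteq> y" if "y \<in> carrier D" "\<And>k. C k \<sqsubseteq> y" for y
    using s Cc that by (subst (asm) is_lub_iff) auto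
  have gC: "g (C i) \<sqsubseteq> s" for i
  proof (rule le_if_compacts_below[OF alg gclosed[OF Cc] sc])
    fix b assume b: "b \<in> compacts D" "b \<sqsubseteq> g (C i)"
    then obtain n where n: "e n = b"
      using e_surj by blast
    \<comment> \<open>Stage \<open>k\<close> is late enough in two respects: \<open>e n\<close> is
      among the elements tested, and \<open>g (C k)\<close> lies above
      \<open>g (C i)\<close>.\<close>
    define k where "k = max n i"
    have "g (C i) \<sqsubseteq> g (C k)"
      using chain_mono[of C, OF Cc step] by (simp add: gmono Cc k_def)
    then have "b \<sqsubseteq> g (C k)"
      using le_trans[of b "g (C i)" "g (C k)"] b comp gclosed[OF Cc] by blast
    then have "b \<sqsubseteq> C (Suc k)"
      using CR[of k] n unfolding R_def k_def by (metis max.cobounded1)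
    then show "b \<sqsubseteq> s"
      using le_trans[OF _ Cs[of "Suc k"]] b(1) comp Cc sc by blast
  qed
  have "is_lub D (g s) (g ` range C)"
    using cont dir s unfolding scott_continuous_def by blast
  moreover have "g ` range C \<subseteq> carrier D"
    using Cc gclosed by auto
  ultimately have "g s \<sqsubseteq> s"
    using gC sc by (simp add: is_lub_iff)
  moreover have "s \<sqsubseteq> g s"
  proof (rule s_least)
    show "C k \<sqsubseteq> g s" for k
      using le_trans[OF step le_trans[OF le_g gmono[OF Cc sc Cs]]] Cc sc gclosed by simp
  qed (use sc gclosed in blast)
  ultimately have fix_s: "g s = s"
    using le_antisym sc gclosed by blast
  have itc: "(g ^^ k) \<bottom> \<in> carrier D" for k
    by (induction k) (auto simp: gclosed)
  have it_le: "(g ^^ k) \<bottom> \<sqsubseteq> s" for k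
  proof (induction k)
    case (Suc k)
    then show ?case
      using gmono[OF itc sc] fix_s by simp
  qed (simp add: sc)
  \<comment> \<open>Each iterate lies between \<open>C k\<close> and \<open>s\<close>, so the
    iterates have the same supremum as the chain.\<close>
  have C_it: "C k \<sqsubseteq> (g ^^ k) \<bottom>" for k
  proof (induction k)
    case (Suc k)
    then show ?case
      using le_trans[OF le_g gmono[OF Cc itc]] Cc itc gclosed by simp
  qed (simp add: C)
  have "is_lub D s (range (\<lambda>k. (g ^^ k) \<bottom>))"
  proof (subst is_lub_iff, use itc in blast, intro conjI ballI impI)
    fix y assume y: "y \<in> carrier D" "\<forall>a\<in>range (\<lambda>k. (g ^^ k) \<bottom>). a \<sqsubseteq> y"
    then show "s \<sqsubseteq> y"
      using le_trans[OF C_it _ Cc itc] by (intro s_least) auto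
  qed (use sc it_le in auto)
  then have "kleene_lfp D g = s"
    by (rule is_lub_kleene_lfp)
  with that[of C] C step le_g s fix_s show thesis
    by simp
qed

section \<open>Covers and covering sequences\<close>

text \<open>
  The chains of covers in \<^const>\<open>incremental_domain\<close> are not required to consist of compact
  elements, whereas covering sequences are.
\<close>

lemma cover_compact:
  assumes alg: "algebraic D" and b: "b \<in> compacts D" and cov: "covers D b c"
  shows "c \<in> compacts D"
proof (rule ccontr)
  assume nc: "c \<notin> compacts D"
  have c: "c \<in> carrier D" "b \<in> carrier D" "b \<sqsubseteq> c" "b \<noteq> c"
    using cov by (auto simp: covers_def)
  have dir: "directed D (compacts_below D c)"
    using alg c by (simp add: algebraic_def)
  \<comment> \<open>A compact \<open>z\<close> with \<open>b \<sqsubseteq> z \<sqsubseteq> c\<close>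
    differs from \<open>c\<close>, which is not compact, so the cover forces \<open>z = b\<close>.
    By directedness every compact \<open>e \<sqsubseteq> c\<close> lies below such a
    \<open>z\<close>.\<close>
  have "c \<sqsubseteq> b"
  proof (rule le_if_compacts_below[OF alg c(1,2)])
    fix e assume e: "e \<in> compacts D" "e \<sqsubseteq> c"
    have "b \<in> compacts_below D c" "e \<in> compacts_below D c"
      using b e c by (auto simp: compacts_below_def)
    then obtain z where z: "z \<in> compacts_below D c" "b \<sqsubseteq> z" "e \<sqsubseteq> z"
      using dir unfolding directed_def by blast
    then have "z \<in> carrier D" "z \<sqsubseteq> c" "z \<noteq> c"
      using nc by (auto simp: compacts_below_def compacts_def)
    then have "z = b"
      using cov z unfolding covers_def by blast
    with z show "e \<sqsubseteq> b"
      by simp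
  qed
  with c show False
    using le_antisym by blast
qed

text \<open>The induction starts from the lower end because compactness passes upwards along a
  cover. The path is a list so that paths can be concatenated.\<close>

lemma covering_path:
  assumes alg: "algebraic D" and "(covers D)\<^sup>*\<^sup>* b c" "b \<in> compacts D"
  shows "\<exists>q. successively (covers D) (b # q) \<and> set (b # q) \<subseteq> compacts_below D c \<and> last (b # q) = c"
  using assms(2,3)
proof (induction rule: converse_rtranclp_induct)
  case base
  then show ?case
    by (intro exI[of _ "[]"]) (auto simp: compacts_below_def compacts_def)
next
  case (step b b')
  have "b' \<in> compacts D"
    using cover_compact alg step by blast
  then obtain q where q: "successively (covers D) (b' # q)"
      "set (b' # q) \<subseteq> compacts_below D c" "last (b' # q) = c"
    using step.IH by blast
  have "c \<in> compacts_below D c"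
    using last_in_set[of "b' # q"] q(2,3) by auto
  then have "c \<in> carrier D"
    by (simp add: compacts_below_def compacts_def)
  then have "b \<sqsubseteq> c"
    using step.hyps(1) q(2) by (auto simp: covers_def compacts_below_def intro: le_trans[of b b' c])
  then show ?case
    using q step by (intro exI[of _ "b' # q"]) (auto simp: compacts_below_def)
qed

end

text \<open>Incrementality joins \<bottom> to \<open>u\<close> by finitely many covers; the path
  goes on to \<open>v\<close> and is then prolonged again and again, at stage \<open>n\<close> to a
  compact element above the \<open>n\<close>-th compact element below \<open>t\<close>. The end
  points are therefore cofinal among the compact elements below \<open>t\<close>.\<close>

lemma covering_sequence_through:
  assumes inc: "incremental_domain D" and t: "t \<in> carrier D" and uv: "covers_relative D t u v"
  obtains N x m where "covering_sequence_for D t N x" "enat (Suc m) < N" "x m = u" "x (Suc m) = v"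
proof -
  have alg: "algebraic D" and cnt: "countable (compacts D)"
    and cov: "\<And>b c. \<lbrakk>b \<in> compacts D; c \<in> compacts D; b \<sqsubseteq>\<^bsub>D\<^esub> c\<rbrakk> \<Longrightarrow> (covers D)\<^sup>*\<^sup>* b c"
    using inc by (auto simp: incremental_domain_def omega_algebraic_def)
  interpret cpo D
    using alg by (simp add: algebraic_def)
  have dir: "directed D (compacts_below D t)" and lub: "is_lub D t (compacts_below D t)"
    using alg t by (auto simp: algebraic_def)
  have cb: "compacts_below D t \<subseteq> carrier D" "compacts_below D c \<subseteq> compacts D" for c
    by (auto simp: compacts_below_def compacts_def)
  have below: "compacts_below D c \<subseteq> compacts_below D t" if "c \<in> compacts_below D t" for c
    using that t le_trans[of _ c t] by (auto simp: compacts_below_def compacts_def)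
  have u: "u \<in> compacts_below D t" and v: "v \<in> compacts_below D t" and "covers D u v"
    using uv by (auto simp: covers_relative_def)
  define e where "e = from_nat_into (compacts_below D t)"
  have e: "e k \<in> compacts_below D t" for k
    unfolding e_def using u by (blast intro: from_nat_into)
  have e_surj: "\<exists>n. e n = b" if "b \<in> compacts_below D t" for b
    unfolding e_def using cnt cb that from_nat_into_surj countable_subset by metis
  \<comment> \<open>The sequence is the union of a growing sequence of finite paths; the lengths become stationary
    exactly when \<open>t\<close> is compact, so no case distinction is needed.\<close>
  define good where "good p \<longleftrightarrow> p \<noteq> [] \<and> hd p = \<bottom>\<^bsub>D\<^esub> \<and> successively (covers D) p \<and>
    set p \<subseteq> compacts_below D t" for p
  \<comment> \<open>Paths are glued at the shared node \<open>last p\<close>, so only the tail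
    \<open>q\<close>, possibly empty, is appended.\<close>
  have extend: "\<exists>q. good (p @ q) \<and> last (p @ q) = c"
    if p: "good p" and c: "c \<in> compacts_below D t" "last p \<sqsubseteq>\<^bsub>D\<^esub> c" for p c
  proof -
    have lp: "last p \<in> compacts D"
      using p last_in_set[of p] cb(2)[of t] unfolding good_def by blast
    moreover have "(covers D)\<^sup>*\<^sup>* (last p) c"
      using cov c lp cb by blast
    ultimately obtain q where q: "successively (covers D) (last p # q)"
        "set (last p # q) \<subseteq> compacts_below D c" "last (last p # q) = c"
      using covering_path[OF alg] by blast
    have "good (p @ q)"
      using p q below[OF c(1)] by (auto simp: good_def successively_append_iff successively_Cons)
    moreover have "last (p @ q) = c"
      using q(3) by (cases q) auto
    ultimately show ?thesis
      by blast
  qed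
  have "good [\<bottom>\<^bsub>D\<^esub>]"
    using bottom_compact t by (auto simp: good_def compacts_below_def)
  moreover have "last [\<bottom>\<^bsub>D\<^esub>] \<sqsubseteq>\<^bsub>D\<^esub> u"
    using u cb by auto
  ultimately obtain p0 where p0: "good p0" "last p0 = u"
    using extend[of "[\<bottom>\<^bsub>D\<^esub>]" u] u by blast
  define r where "r = p0 @ [v]"
  have r: "good r"
    using p0 v \<open>covers D u v\<close> by (auto simp: good_def r_def successively_append_iff)
  have "\<exists>p. \<forall>n. (good (p n) \<and> (n = 0 \<longrightarrow> p n = r)) \<and>
      ((\<exists>q. p (Suc n) = p n @ q) \<and> e n \<sqsubseteq>\<^bsub>D\<^esub> last (p (Suc n)))"
  proof (rule dependent_nat_choice)
    show "\<exists>p. good p \<and> ((0::nat) = 0 \<longrightarrow> p = r)"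
      using r by blast
  next
    fix p and n :: nat
    assume "good p \<and> (n = 0 \<longrightarrow> p = r)"
    then have p: "good p" ..
    have "last p \<in> compacts_below D t"
      using p by (auto simp: good_def)
    then obtain c where "c \<in> compacts_below D t" "last p \<sqsubseteq>\<^bsub>D\<^esub> c" "e n \<sqsubseteq>\<^bsub>D\<^esub> c"
      using dir e unfolding directed_def by blast
    then show "\<exists>p'. (good p' \<and> (Suc n = 0 \<longrightarrow> p' = r)) \<and> (\<exists>q. p' = p @ q) \<and> e n \<sqsubseteq>\<^bsub>D\<^esub> last p'"
      using extend[OF p] by (metis nat.distinct(1))
  qed
  then obtain p where p: "\<And>n. good (p n)" "p 0 = r"
    and p_ext: "\<And>n. \<exists>q. p (Suc n) = p n @ q" and p_e: "\<And>n. e n \<sqsubseteq>\<^bsub>D\<^esub> last (p (Suc n))"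
    by metis
  have prefix: "\<exists>q. p n = p m @ q" if "m \<le> n" for m n
    using that
  proof (induction n rule: dec_induct)
    case (step n)
    then show ?case
      using p_ext[of n] by auto
  qed simp
  \<comment> \<open>The limit of the growing paths: \<open>N\<close> is infinite iff the lengths are
    unbounded, and by the prefix property entry \<open>i\<close> can be read off any path that is
    long enough.\<close>
  define N where "N = (SUP k. enat (length (p k)))"
  define x where "x i = p (LEAST k. i < length (p k)) ! i" for i
  have x: "x i = p k ! i" if "i < length (p k)" for i k
  proof -
    let ?l = "LEAST k. i < length (p k)"
    have "i < length (p ?l)" "?l \<le> k"
      using that by (auto intro: LeastI Least_le)
    then show ?thesis
      using prefix[of ?l k] by (auto simp: x_def nth_append)
  qed
  have N: "enat i < N \<longleftrightarrow> (\<exists>k. i < length (p k))" for i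
    by (simp add: N_def less_SUP_iff)
  have x_mem: "x i \<in> compacts_below D t" if "enat i < N" for i
    using that p(1) x unfolding N good_def by (metis nth_mem subset_iff)
  have mem_x: "\<exists>i. b = x i \<and> enat i < N" if "b \<in> set (p k)" for b k
    using that x N by (metis in_set_conv_nth)
  have "covering_sequence D N x"
    unfolding covering_sequence_def
  proof (intro conjI allI impI)
    have "p 0 \<noteq> []"
      using p(1) by (simp add: good_def)
    then have "enat 0 < N"
      using N by blast
    then show "N \<noteq> 0"
      by auto
    show "x 0 = \<bottom>\<^bsub>D\<^esub>"
      using x[of 0 0] p(1)[of 0] hd_conv_nth[of "p 0"] by (simp add: good_def)
    show "x k \<in> compacts D" if "enat k < N" for k
      using x_mem[OF that] cb by blast
    show "covers D (x k) (x (Suc k))" if k: "enat (Suc k) < N" for k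
    proof -
      obtain l where "Suc k < length (p l)"
        using N k by blast
      then show ?thesis
        using successively_nth[of "covers D" "p l" k] p(1)[of l] x[of k l] x[of "Suc k" l]
        by (simp add: good_def)
    qed
  qed
  moreover
  have "{x k |k. enat k < N} \<subseteq> carrier D"
    using x_mem cb(1) by auto
  then have "is_lub D t {x k |k. enat k < N}"
  proof (subst is_lub_iff, assumption, intro conjI ballI impI)
    show "a \<sqsubseteq>\<^bsub>D\<^esub> t" if "a \<in> {x k |k. enat k < N}" for a
      using that x_mem by (auto simp: compacts_below_def)
  next
    fix y assume y: "y \<in> carrier D" "\<forall>a\<in>{x k |k. enat k < N}. a \<sqsubseteq>\<^bsub>D\<^esub> y"
    show "t \<sqsubseteq>\<^bsub>D\<^esub> y"
    proof (rule le_if_compacts_below[OF alg t y(1)])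
      fix b assume "b \<in> compacts D" "b \<sqsubseteq>\<^bsub>D\<^esub> t"
      then obtain n where n: "e n = b"
        using e_surj by (auto simp: compacts_below_def)
      \<comment> \<open>The index is \<open>Suc n\<close> because the end of
        \<open>p (Suc n)\<close> is the one that was chosen above \<open>e n\<close>.\<close>
      let ?z = "last (p (Suc n))"
      have "?z \<in> set (p (Suc n))"
        using p(1) by (simp add: good_def)
      then have "?z \<sqsubseteq>\<^bsub>D\<^esub> y" "?z \<in> carrier D"
        using mem_x[of ?z "Suc n"] y(2) x_mem cb(1) by auto
      moreover have "b \<sqsubseteq>\<^bsub>D\<^esub> ?z" "b \<in> carrier D"
        using p_e[of n] n e[of n] cb(1) by auto
      ultimately show "b \<sqsubseteq>\<^bsub>D\<^esub> y"
        using le_trans[of b ?z y] y(1) by blast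
    qed
  qed (rule t)
  \<comment> \<open>\<open>p0\<close> ends in \<open>u\<close>, so \<open>u\<close> has index
    \<open>length p0 - 1\<close>, and \<open>v\<close> is the entry that \<open>r = p 0\<close> adds
    after it.\<close>
  moreover define m where "m = length p0 - 1"
  have "p0 \<noteq> []"
    using p0 by (simp add: good_def)
  then have m: "length (p 0) = Suc (Suc m)" "p 0 ! m = u" "p 0 ! Suc m = v"
    using p(2) p0(2) by (auto simp: r_def m_def nth_append last_conv_nth)
  then have "enat (Suc m) < N" "x m = u" "x (Suc m) = v"
    using N[of "Suc m"] x[of m 0] x[of "Suc m" 0] by (auto intro: exI[of _ 0])
  ultimately show thesis
    using that by (auto simp: covering_sequence_for_def)
qed

section \<open>Suprema in products of value domains\<close>

lemma vals_carrier: "carrier (vals M S) = (\<Pi>\<^sub>E \<alpha>\<in>S. carrier (val M \<alpha>))"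
  and vals_le: "x \<sqsubseteq>\<^bsub>vals M S\<^esub> y \<longleftrightarrow> (\<forall>\<alpha>\<in>S. x \<alpha> \<sqsubseteq>\<^bsub>val M \<alpha>\<^esub> y \<alpha>)"
  by (simp_all add: vals_def)

lemma restrict_vals:
  "\<lbrakk>x \<in> carrier (vals M S); U \<subseteq> S\<rbrakk> \<Longrightarrow> restrict x U \<in> carrier (vals M U)"
  by (auto simp: vals_carrier)

context model
begin

lemma is_lub_valsI:
  assumes "A \<subseteq> carrier (vals M S)" "s \<in> carrier (vals M S)"
    and "\<And>\<alpha>. \<alpha> \<in> S \<Longrightarrow> is_lub (val M \<alpha>) (s \<alpha>) ((\<lambda>x. x \<alpha>) ` A)"
  shows "is_lub (vals M S) s A"
proof -
  have "(\<lambda>x. x \<alpha>) ` A \<subseteq> carrier (val M \<alpha>)" if "\<alpha> \<in> S" for \<alpha>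
    using assms(1) that by (auto simp: vals_carrier)
  then have component: "(\<forall>x\<in>A. x \<alpha> \<sqsubseteq>\<^bsub>val M \<alpha>\<^esub> s \<alpha>) \<and>
      (\<forall>y\<in>carrier (val M \<alpha>). (\<forall>x\<in>A. x \<alpha> \<sqsubseteq>\<^bsub>val M \<alpha>\<^esub> y) \<longrightarrow> s \<alpha> \<sqsubseteq>\<^bsub>val M \<alpha>\<^esub> y)" if "\<alpha> \<in> S" for \<alpha>
    using assms(3)[OF that] that by (simp add: is_lub_iff)
  have "s \<alpha> \<sqsubseteq>\<^bsub>val M \<alpha>\<^esub> y \<alpha>"
    if "y \<in> carrier (vals M S)" "\<forall>a\<in>A. a \<sqsubseteq>\<^bsub>vals M S\<^esub> y" "\<alpha> \<in> S" for y \<alpha>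
  proof -
    have "y \<alpha> \<in> carrier (val M \<alpha>)" "\<forall>a\<in>A. a \<alpha> \<sqsubseteq>\<^bsub>val M \<alpha>\<^esub> y \<alpha>"
      using that by (auto simp: vals_carrier vals_le)
    with component[OF that(3)] show ?thesis
      by blast
  qed
  then show ?thesis
    using assms(1,2) component by (simp add: is_lub_iff vals_le)
qed

text \<open>Every coordinate of \<open>A\<close> is directed and has a supremum by completeness of
  the factor. These suprema together form a supremum of \<open>A\<close>, which is unique and hence
  equals \<open>s\<close>.\<close>

lemma is_lub_vals_component:
  assumes cpo: "cpo (vals M S)" and dir: "directed (vals M S) A"
    and lub: "is_lub (vals M S) s A" and \<alpha>: "\<alpha> \<in> S"
  shows "is_lub (val M \<alpha>) (s \<alpha>) ((\<lambda>x. x \<alpha>) ` A)"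
proof -
  interpret V: cpo "vals M S"
    by (rule cpo)
  have "\<exists>z. is_lub (val M \<beta>) z ((\<lambda>x. x \<beta>) ` A)" if "\<beta> \<in> S" for \<beta>
  proof -
    have "directed (val M \<beta>) ((\<lambda>x. x \<beta>) ` A)"
      using dir that by (rule_tac directed_image[of "vals M S"]) (auto simp: vals_carrier vals_le)
    then show ?thesis
      using cpo.directed_complete[OF val_cpo] by blast
  qed
  then obtain z where z: "\<And>\<beta>. \<beta> \<in> S \<Longrightarrow> is_lub (val M \<beta>) (z \<beta>) ((\<lambda>x. x \<beta>) ` A)"
    by metis
  \<comment> \<open>\<open>z\<close> is cut down to \<open>S\<close> since members of the product
    are \<open>undefined\<close> elsewhere.\<close>
  have "is_lub (vals M S) (restrict z S) A"
  proof (rule is_lub_valsI)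
    show "A \<subseteq> carrier (vals M S)"
      using dir by (simp add: directed_def)
    show "restrict z S \<in> carrier (vals M S)"
      using is_lub_closed[OF z] by (auto simp: vals_carrier)
  qed (simp add: z)
  then have "s = restrict z S"
    using V.least_unique lub by blast
  then show ?thesis
    using z \<alpha> by simp
qed

lemma scott_continuous_restrict:
  assumes S: "cpo (vals M S)" and U: "cpo (vals M U)" and "U \<subseteq> S"
  shows "scott_continuous (vals M S) (vals M U) (\<lambda>x. restrict x U)"
proof -
  interpret VS: cpo "vals M S" by (rule S)
  interpret VU: cpo "vals M U" by (rule U)
  show ?thesis
    unfolding scott_continuous_def
  proof (intro conjI allI impI, goal_cases)
    case 1
    show ?case
      using \<open>U \<subseteq> S\<close> restrict_vals by blast
  next
    case 2
    show ?case
      using \<open>U \<subseteq> S\<close> VS.weak_partial_order_axioms VU.weak_partial_order_axioms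
      by (intro isotoneI) (auto simp: vals_le)
  next
    case (3 A s)
    then have A: "A \<subseteq> carrier (vals M S)"
      by (simp add: directed_def)
    show ?case
    proof (rule is_lub_valsI)
      fix \<alpha> assume "\<alpha> \<in> U"
      then have "is_lub (val M \<alpha>) (s \<alpha>) ((\<lambda>x. x \<alpha>) ` A)"
        using is_lub_vals_component[OF S] 3 \<open>U \<subseteq> S\<close> by blast
      then show "is_lub (val M \<alpha>) (restrict s U \<alpha>) ((\<lambda>x. x \<alpha>) ` (\<lambda>x. restrict x U) ` A)"
        using \<open>\<alpha> \<in> U\<close> by (simp add: image_image)
    next
      show "(\<lambda>x. restrict x U) ` A \<subseteq> carrier (vals M U)"
        using A \<open>U \<subseteq> S\<close> by (auto intro: restrict_vals)
      show "restrict s U \<in> carrier (vals M U)"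
        using 3 \<open>U \<subseteq> S\<close> by (auto intro: restrict_vals is_lub_closed)
    qed
  qed
qed

section \<open>Continuity of the network map\<close>

text \<open>Suprema are coordinatewise, and every coordinate is a composite of three maps preserving
  directed suprema: restriction to \<open>I j\<close>, the map \<open>f j\<close>, and evaluation at
  the channel.\<close>

lemma scott_continuous_network_map:
  assumes cpo: "\<And>U. cpo (vals M U)"
    and f: "\<And>j. j \<in> J \<Longrightarrow> scott_continuous (vals M (I j)) (vals M (Out j)) (f j)"
    and I: "\<And>j. j \<in> J \<Longrightarrow> I j \<subseteq> S"
    and uniq: "\<And>\<alpha>. \<alpha> \<in> S \<Longrightarrow> \<exists>!j. j \<in> J \<and> \<alpha> \<in> Out j"
  shows "scott_continuous (vals M S) (vals M S) (network_map J S I Out f)"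
proof -
  let ?G = "network_map J S I Out f"
  interpret VS: cpo "vals M S" by (rule cpo)
  \<comment> \<open>The producer \<open>j\<close> depends on the channel alone, so one
    \<open>j\<close> serves for all arguments \<open>x\<close>.\<close>
  have component: "\<exists>j\<in>J. \<alpha> \<in> Out j \<and> (\<forall>x. ?G x \<alpha> = f j (restrict x (I j)) \<alpha>)"
    if "\<alpha> \<in> S" for \<alpha>
    using theI'[OF uniq[OF that]] that by (auto simp: network_map_def Let_def)
  have closed: "?G x \<in> carrier (vals M S)" if x: "x \<in> carrier (vals M S)" for x
  proof -
    have "?G x \<alpha> \<in> carrier (val M \<alpha>)" if "\<alpha> \<in> S" for \<alpha>
    proof -
      obtain j where j: "j \<in> J" "\<alpha> \<in> Out j" "?G x \<alpha> = f j (restrict x (I j)) \<alpha>"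
        using component \<open>\<alpha> \<in> S\<close> by blast
      have "f j (restrict x (I j)) \<in> carrier (vals M (Out j))"
        using f[OF j(1)] restrict_vals[OF x I[OF j(1)]] by (auto simp: scott_continuous_def)
      then show ?thesis
        using j by (auto simp: vals_carrier)
    qed
    then show ?thesis
      by (auto simp: vals_carrier network_map_def)
  qed
  show ?thesis
    unfolding scott_continuous_def
  proof (intro conjI allI impI, goal_cases)
    case 1
    show ?case
      using closed by blast
  next
    case 2
    show ?case
    proof (intro isotoneI VS.weak_partial_order_axioms)
      fix x y assume xy: "x \<in> carrier (vals M S)" "y \<in> carrier (vals M S)" "x \<sqsubseteq>\<^bsub>vals M S\<^esub> y"
      have "?G x \<alpha> \<sqsubseteq>\<^bsub>val M \<alpha>\<^esub> ?G y \<alpha>" if "\<alpha> \<in> S" for \<alpha>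
      proof -
        obtain j where j: "j \<in> J" "\<alpha> \<in> Out j" "\<And>x. ?G x \<alpha> = f j (restrict x (I j)) \<alpha>"
          using component \<open>\<alpha> \<in> S\<close> by blast
        have "restrict x (I j) \<sqsubseteq>\<^bsub>vals M (I j)\<^esub> restrict y (I j)"
          using xy I[OF j(1)] by (auto simp: vals_le)
        then have "f j (restrict x (I j)) \<sqsubseteq>\<^bsub>vals M (Out j)\<^esub> f j (restrict y (I j))"
          using f[OF j(1)] xy(1,2)[THEN restrict_vals, OF I[OF j(1)]]
          by (auto simp: scott_continuous_def isotone_def)
        then show ?thesis
          using j by (simp add: vals_le)
      qed
      then show "?G x \<sqsubseteq>\<^bsub>vals M S\<^esub> ?G y"
        by (simp add: vals_le)
    qed
  next
    case (3 A s)
    then have dir: "directed (vals M S) A" and lub: "is_lub (vals M S) s A"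
      by auto
    have A: "A \<subseteq> carrier (vals M S)"
      using dir by (simp add: directed_def)
    show ?case
    proof (rule is_lub_valsI)
      fix \<alpha> assume "\<alpha> \<in> S"
      then obtain j where j: "j \<in> J" "\<alpha> \<in> Out j" "\<And>x. ?G x \<alpha> = f j (restrict x (I j)) \<alpha>"
        using component by blast
      let ?r = "\<lambda>x. restrict x (I j)"
      have r: "scott_continuous (vals M S) (vals M (I j)) ?r"
        using scott_continuous_restrict cpo I[OF j(1)] by blast
      have dr: "directed (vals M (I j)) (?r ` A)"
        using r dir by (rule directed_image_scott_continuous)
      have "is_lub (vals M (I j)) (?r s) (?r ` A)"
        using r dir lub unfolding scott_continuous_def by blast
      then have "is_lub (vals M (Out j)) (f j (?r s)) (f j ` ?r ` A)"
        using f[OF j(1)] dr unfolding scott_continuous_def by blast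
      moreover have "directed (vals M (Out j)) (f j ` ?r ` A)"
        using f[OF j(1)] dr by (rule directed_image_scott_continuous)
      ultimately have "is_lub (val M \<alpha>) (f j (?r s) \<alpha>) ((\<lambda>x. x \<alpha>) ` f j ` ?r ` A)"
        using is_lub_vals_component cpo j(2) by blast
      then show "is_lub (val M \<alpha>) (?G s \<alpha>) ((\<lambda>x. x \<alpha>) ` ?G ` A)"
        by (simp add: j(3) image_image)
    next
      show "?G ` A \<subseteq> carrier (vals M S)"
        using A closed by blast
      show "?G s \<in> carrier (vals M S)"
        using closed is_lub_closed[OF lub] by blast
    qed
  qed
qed

section \<open>Causality along a trace\<close>

text \<open>This yields the second condition of \<open>computes\<close> for the network as a whole,
  once \<open>g\<close> is taken to be the network map.\<close>

lemma obs_le_if_causal: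
  assumes inc: "incremental_domain (trc M S)" and alg: "algebraic (vals M S)"
    and g: "scott_continuous (vals M S) (vals M S) g"
    and C: "C 0 = \<bottom>\<^bsub>vals M S\<^esub>" "\<And>k. C k \<in> compacts (vals M S)"
      "\<And>k. C k \<sqsubseteq>\<^bsub>vals M S\<^esub> C (Suc k)" "\<And>k. C (Suc k) \<sqsubseteq>\<^bsub>vals M S\<^esub> g (C k)"
      "is_lub (vals M S) (obs M S t) (range C)"
    and t: "t \<in> carrier (trc M S)"
    and causal: "\<And>b c. \<lbrakk>b \<in> compacts_below (vals M S) (obs M S t);
        c \<in> compacts_below (vals M S) (obs M S t); chain_less (vals M S) C b c\<rbrakk> \<Longrightarrow> trace_less M S t b c"
    and uv: "covers_relative (trc M S) t u v"
  shows "obs M S v \<sqsubseteq>\<^bsub>vals M S\<^esub> g (obs M S u)"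
proof -
  interpret V: cpo "vals M S"
    using alg by (simp add: algebraic_def)
  interpret T: cpo "trc M S"
    by (rule trc_cpo)
  have obs: "scott_continuous (trc M S) (vals M S) (obs M S)"
    using obs_strict_continuous by (simp add: strict_continuous_def)
  have obs_closed: "x \<in> carrier (trc M S) \<Longrightarrow> obs M S x \<in> carrier (vals M S)" for x
    using obs by (auto simp: scott_continuous_def)
  have obs_mono: "\<lbrakk>x \<in> carrier (trc M S); y \<in> carrier (trc M S); x \<sqsubseteq>\<^bsub>trc M S\<^esub> y\<rbrakk>
      \<Longrightarrow> obs M S x \<sqsubseteq>\<^bsub>vals M S\<^esub> obs M S y" for x y
    using obs by (auto simp: scott_continuous_def isotone_def)
  have g_closed: "x \<in> carrier (vals M S) \<Longrightarrow> g x \<in> carrier (vals M S)" for x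
    using g by (auto simp: scott_continuous_def)
  have g_mono: "\<lbrakk>x \<in> carrier (vals M S); y \<in> carrier (vals M S); x \<sqsubseteq>\<^bsub>vals M S\<^esub> y\<rbrakk>
      \<Longrightarrow> g x \<sqsubseteq>\<^bsub>vals M S\<^esub> g y" for x y
    using g by (auto simp: scott_continuous_def isotone_def)
  have comp: "b \<in> compacts (vals M S) \<Longrightarrow> b \<in> carrier (vals M S)" for b
    by (simp add: compacts_def)
  have Cc: "C k \<in> carrier (vals M S)" for k
    using C(2) comp by blast
  have Cle: "C k \<sqsubseteq>\<^bsub>vals M S\<^esub> obs M S t" for k
    using C(5) Cc by (subst (asm) is_lub_iff) auto
  have dirC: "directed (vals M S) (range C)"
    using V.directed_chain Cc C(3) by blast
  have uc: "u \<in> carrier (trc M S)" and vc: "v \<in> carrier (trc M S)" and vt: "v \<sqsubseteq>\<^bsub>trc M S\<^esub> t"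
    using uv by (auto simp: covers_relative_def compacts_below_def compacts_def)
  obtain N x m where x: "covering_sequence_for (trc M S) t N x"
    and m: "enat (Suc m) < N" "x m = u" "x (Suc m) = v"
    using covering_sequence_through[OF inc t uv] by metis
  have xs: "covering_sequence (trc M S) N x" and xlub: "is_lub (trc M S) t {x k |k. enat k < N}"
    using x by (auto simp: covering_sequence_for_def)
  have xc: "x k \<in> carrier (trc M S)" if "enat k < N" for k
    using xs that by (auto simp: covering_sequence_def compacts_def)
  have x_mono: "x i \<sqsubseteq>\<^bsub>trc M S\<^esub> x k" if "i \<le> k" "enat k < N" for i k
    using that
  proof (induction k rule: dec_induct)
    case base
    then show ?case
      using xc by simp
  next
    case (step k)
    then have k: "enat k < N"
      using order.strict_trans[of "enat k" "enat (Suc k)" N] by simp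
    moreover have "i \<le> k"
      using step by simp
    ultimately have "x i \<sqsubseteq>\<^bsub>trc M S\<^esub> x k" "enat i < N"
      using step.IH by (auto intro: le_less_trans[of "enat i" "enat k"])
    moreover have "x k \<sqsubseteq>\<^bsub>trc M S\<^esub> x (Suc k)"
      using xs step by (auto simp: covering_sequence_def covers_def)
    ultimately show ?case
      using T.le_trans[of "x i" "x k" "x (Suc k)"] xc k step by blast
  qed
  have xdir: "directed (trc M S) {x k |k. enat k < N}"
    unfolding directed_def
  proof (intro conjI ballI)
    show "{x k |k. enat k < N} \<noteq> {}"
      using m by blast
    fix y z assume "y \<in> {x k |k. enat k < N}" "z \<in> {x k |k. enat k < N}"
    then obtain i k where ik: "y = x i" "z = x k" "enat i < N" "enat k < N"
      by blast
    then have "enat (max i k) < N"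
      by (simp add: max_def)
    with ik show "\<exists>w\<in>{x k |k. enat k < N}. y \<sqsubseteq>\<^bsub>trc M S\<^esub> w \<and> z \<sqsubseteq>\<^bsub>trc M S\<^esub> w"
      using x_mono[of i "max i k"] x_mono[of k "max i k"] by auto
  qed (use xc in blast)
  \<comment> \<open>The observations along the covering sequence are directed with supremum
    \<open>obs M S t\<close>, so a compact element below it is reached at a finite stage. Hence the
    \<open>LEAST\<close> index for such an element is a true minimum.\<close>
  have observed: "\<exists>k. enat k < N \<and> b \<sqsubseteq>\<^bsub>vals M S\<^esub> obs M S (x k)"
    if "b \<in> compacts (vals M S)" "b \<sqsubseteq>\<^bsub>vals M S\<^esub> obs M S t" for b
  proof -
    have "is_lub (vals M S) (obs M S t) (obs M S ` {x k |k. enat k < N})"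
      using obs xdir xlub unfolding scott_continuous_def by blast
    from compacts_inaccessible[OF that(1) directed_image_scott_continuous[OF obs xdir] this that(2)]
    show ?thesis
      by auto
  qed
  show ?thesis
  proof (rule V.le_if_compacts_below[OF alg obs_closed[OF vc] g_closed[OF obs_closed[OF uc]]])
    fix e assume e: "e \<in> compacts (vals M S)" "e \<sqsubseteq>\<^bsub>vals M S\<^esub> obs M S v"
    have et: "e \<sqsubseteq>\<^bsub>vals M S\<^esub> obs M S t"
      by (rule V.le_trans[OF e(2) obs_mono[OF vc t vt] comp[OF e(1)] obs_closed[OF vc] obs_closed[OF t]])
    then have ex: "\<exists>k. e \<sqsubseteq>\<^bsub>vals M S\<^esub> C k"
      using compacts_inaccessible[OF e(1) dirC C(5)] et by auto
    define n where "n = chain_norm (vals M S) C e"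
    have en: "e \<sqsubseteq>\<^bsub>vals M S\<^esub> C n"
      unfolding n_def chain_norm_def using ex by (rule LeastI_ex)
    show "e \<sqsubseteq>\<^bsub>vals M S\<^esub> g (obs M S u)"
    proof (cases n)
      \<comment> \<open>No earlier member of the chain exists here, but \<open>e\<close> lies below
        \<open>C 0\<close>, which is \<bottom>.\<close>
      case 0
      then show ?thesis
        using V.le_trans[of e "\<bottom>\<^bsub>vals M S\<^esub>"] en C(1) e(1) comp uc obs_closed g_closed by auto
    next
      case (Suc k)
      \<comment> \<open>Equality may fail, as the chain can be stationary; the bound is enough for
        \<open>C k\<close> to precede \<open>e\<close>, whose norm is \<open>Suc k\<close>.\<close>
      have "chain_norm (vals M S) C (C k) \<le> k"
        unfolding chain_norm_def using Cc by (intro Least_le) simp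
      then have "chain_less (vals M S) C (C k) e"
        using Suc by (simp add: chain_less_def n_def)
      then have "trace_less M S t (C k) e"
        using C(2) Cle e(1) et by (intro causal) (auto simp: compacts_below_def)
      then have less: "(LEAST i. enat i < N \<and> C k \<sqsubseteq>\<^bsub>vals M S\<^esub> obs M S (x i))
          < (LEAST i. enat i < N \<and> e \<sqsubseteq>\<^bsub>vals M S\<^esub> obs M S (x i))" (is "?i < ?l")
        using x unfolding trace_less_def by blast
      \<comment> \<open>\<open>v\<close> has index \<open>Suc m\<close> and observes
        \<open>e\<close>. What is observed strictly earlier is observed by index \<open>m\<close>,
        that is, by \<open>u\<close>.\<close>
      have "?l \<le> Suc m"
        using m e(2) by (intro Least_le) simp
      with less have "?i \<le> m"
        by simp
      moreover have i: "enat ?i < N" "C k \<sqsubseteq>\<^bsub>vals M S\<^esub> obs M S (x ?i)"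
        using LeastI_ex[OF observed[OF C(2) Cle], of k] by simp_all
      moreover have "enat m < N"
        using m(1) order.strict_trans[of "enat m" "enat (Suc m)" N] by simp
      ultimately have "obs M S (x ?i) \<sqsubseteq>\<^bsub>vals M S\<^esub> obs M S u"
        using x_mono[of ?i m] m(2) xc[of ?i] uc by (simp add: obs_mono)
      then have "C k \<sqsubseteq>\<^bsub>vals M S\<^esub> obs M S u"
        by (rule V.le_trans[OF i(2) _ Cc obs_closed[OF xc[OF i(1)]] obs_closed[OF uc]])
      then have "g (C k) \<sqsubseteq>\<^bsub>vals M S\<^esub> g (obs M S u)"
        by (rule g_mono[OF Cc obs_closed[OF uc]])
      moreover have "e \<sqsubseteq>\<^bsub>vals M S\<^esub> g (C k)"
        using en Suc by (intro V.le_trans[OF _ C(4) comp[OF e(1)] Cc g_closed[OF Cc]]) simp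
      ultimately show ?thesis
        using comp[OF e(1)] g_closed Cc obs_closed[OF uc] by (blast intro: V.le_trans[of e "g (C k)"])
    qed
  qed
qed

end

section \<open>From the global trace to the component processes\<close>

theorem theorem2:
  fixes M :: "('c, 't, 'v) model_data"
    and J :: "'j set"
    and Q :: "'j \<Rightarrow> ('c, 't) process"
    and I Out :: "'j \<Rightarrow> 'c set"
    and F :: "'j \<Rightarrow> (('c \<Rightarrow> 'v) \<Rightarrow> ('c \<Rightarrow> 'v)) set"
    and S :: "'c set"
    and P :: "'t set"
  assumes "causally_expressive M"
    and "functional_network M J Q I Out F"
    and "(S, P) = network_composition M J Q"
  shows "{kleene_lfp (vals M S) (network_map J S I Out f) | f. f \<in> (\<Pi>\<^sub>E j\<in>J. F j)}
    \<subseteq> obs M S ` P"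
proof -
  have inc: "incremental_model M" and omega: "\<And>U. omega_algebraic (vals M U)"
    using assms(1) by (auto simp: causally_expressive_def)
  interpret model M
    using inc by (simp add: incremental_model_def)
  have alg: "algebraic (vals M U)" for U
    using omega by (simp add: omega_algebraic_def)
  have cpo: "cpo (vals M U)" for U
    using alg by (simp add: algebraic_def)
  have S: "S = (\<Union>j\<in>J. fst (Q j))"
    and P: "P = {t \<in> carrier (trc M S). \<forall>j\<in>J. res M S (fst (Q j)) t \<in> snd (Q j)}"
    using assms(3) by (auto simp: network_composition_def Let_def)
  have comp: "\<And>j. j \<in> J \<Longrightarrow> computes M (Q j) (I j) (Out j) (F j)"
    and uniq: "\<And>\<alpha>. \<alpha> \<in> S \<Longrightarrow> \<exists>!j. j \<in> J \<and> \<alpha> \<in> Out j"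
    using assms(2) unfolding functional_network_def S by blast+
  have fQ: "fst (Q j) = I j \<union> Out j" if "j \<in> J" for j
    using comp[OF that] by (simp add: computes_def Let_def)
  have sub: "I j \<subseteq> S" "Out j \<subseteq> S" "fst (Q j) \<subseteq> S" if "j \<in> J" for j
    using that fQ S by auto
  have "kleene_lfp (vals M S) (network_map J S I Out f) \<in> obs M S ` P"
    if f: "f \<in> (\<Pi>\<^sub>E j\<in>J. F j)" for f
  proof -
    let ?G = "network_map J S I Out f"
    have fj: "f j \<in> continuous_maps (vals M (I j)) (vals M (Out j))" if "j \<in> J" for j
      using comp[OF that] f that by (auto simp: computes_def Let_def)
    have G: "scott_continuous (vals M S) (vals M S) ?G"
      using cpo fj sub uniq
      by (intro scott_continuous_network_map) (auto simp: continuous_maps_def)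
    have G_component: "?G x \<alpha> = f j (restrict x (I j)) \<alpha>" if "j \<in> J" "\<alpha> \<in> Out j" for x j \<alpha>
    proof -
      have "\<alpha> \<in> S"
        using that sub by blast
      moreover have "(THE j. j \<in> J \<and> \<alpha> \<in> Out j) = j"
        using uniq[OF \<open>\<alpha> \<in> S\<close>] that by (intro the1_equality) auto
      ultimately show ?thesis
        by (simp add: network_map_def)
    qed
    define d where "d = kleene_lfp (vals M S) ?G"
    obtain C where C: "C 0 = \<bottom>\<^bsub>vals M S\<^esub>" "\<And>k. C k \<in> compacts (vals M S)"
      "\<And>k. C k \<sqsubseteq>\<^bsub>vals M S\<^esub> C (Suc k)" "\<And>k. C (Suc k) \<sqsubseteq>\<^bsub>vals M S\<^esub> ?G (C k)"
      "is_lub (vals M S) d (range C)" and fix_d: "?G d = d"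
      using cpo.kleene_compact_chain[OF cpo omega G] unfolding d_def by metis
    have "d \<in> carrier (vals M S)"
      using C(5) by (rule is_lub_closed)
    then obtain t where t: "t \<in> carrier (trc M S)" "obs M S t = d"
      and causal: "\<And>b c. \<lbrakk>b \<in> compacts_below (vals M S) d; c \<in> compacts_below (vals M S) d;
        chain_less (vals M S) C b c\<rbrakk> \<Longrightarrow> trace_less M S t b c"
      using assms(1) C unfolding causally_expressive_def by metis
    have main: "obs M S v \<sqsubseteq>\<^bsub>vals M S\<^esub> ?G (obs M S u)" if "covers_relative (trc M S) t u v" for u v
      using inc C t causal that
      by (intro obs_le_if_causal[OF _ alg G, where C = C and t = t]) (auto simp: incremental_model_def)
    have "res M S (fst (Q j)) t \<in> snd (Q j)" if j: "j \<in> J" for j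
    proof -
      let ?S = "fst (Q j)"
      have r: "incremental_morphism (trc M S) (trc M ?S) (res M S ?S)"
        using inc sub(3)[OF j] by (simp add: incremental_model_def)
      have res_closed: "res M S ?S x \<in> carrier (trc M ?S)" if "x \<in> carrier (trc M S)" for x
        using r that by (auto simp: incremental_morphism_def strict_continuous_def scott_continuous_def)
      have obs_res: "obs_res M ?S U (res M S ?S x) = restrict (obs M S x) U"
        if "x \<in> carrier (trc M S)" "U \<subseteq> ?S" for x U
        using that sub(3)[OF j] by (simp add: obs_res_def res_comp obs_natural)
      have IO: "I j \<subseteq> ?S" "Out j \<subseteq> ?S"
        using fQ[OF j] by auto
      \<comment> \<open>Both sides are \<open>undefined\<close> outside \<open>Out j\<close>, so it
        suffices to compare them on the output channels, where \<open>j\<close> is the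
        producer.\<close>
      have G_restrict: "restrict (?G x) (Out j) = f j (restrict x (I j))"
        if "x \<in> carrier (vals M S)" for x
      proof -
        have "f j (restrict x (I j)) \<in> carrier (vals M (Out j))"
          using fj[OF j] restrict_vals[OF that sub(1)[OF j]] by (auto simp: continuous_maps_def)
        then show ?thesis
          using G_component[OF j]
          by (intro extensionalityI[of _ "Out j"]) (auto simp: vals_carrier PiE_def)
      qed
      \<comment> \<open>The first condition of \<open>computes\<close> is the fixed point equation
        for \<open>d\<close>, restricted to \<open>Out j\<close>.\<close>
      have "obs_res M ?S (Out j) (res M S ?S t) = f j (obs_res M ?S (I j) (res M S ?S t))"
        using G_restrict[of d] fix_d t IO \<open>d \<in> carrier (vals M S)\<close> by (simp add: obs_res)
      moreover have "obs_res M ?S (Out j) v \<sqsubseteq>\<^bsub>vals M (Out j)\<^esub> f j (obs_res M ?S (I j) u)"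
        if uv: "covers_relative (trc M ?S) (res M S ?S t) u v" for u v
      proof -
        \<comment> \<open>The lifting clause of incremental morphisms supplies a global cover over
          \<open>u\<close> and \<open>v\<close>; the global inequality \<open>main\<close> for it is
          then read on the channels of \<open>Out j\<close>.\<close>
        obtain u' v' where uv': "covers_relative (trc M S) t u' v'"
          "res M S ?S u' = u" "res M S ?S v' = v"
          using r t(1) uv unfolding incremental_morphism_def by blast
        then have c: "u' \<in> carrier (trc M S)" "v' \<in> carrier (trc M S)"
          by (auto simp: covers_relative_def covers_def)
        show ?thesis
          using main[OF uv'(1)] uv'(2,3) obs_res[OF c(1) IO(1)] obs_res[OF c(2) IO(2)]
            sub(2)[OF j]
          by (auto simp: vals_le subset_iff simp flip: G_component[OF j])
      qed
      moreover have "f j \<in> F j"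
        using f j by blast
      ultimately show ?thesis
        using comp[OF j] res_closed[OF t(1)] unfolding computes_def Let_def by blast
    qed
    then have "t \<in> P"
      using t(1) by (simp add: P)
    then show ?thesis
      using t(2) by (auto simp flip: d_def)
  qed
  then show ?thesis
    by blast
qed

end
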